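(* There is an absolute constant $C>0$ such that for every integer $d \ge 2$ the following holds: if $P \subseteq \mathbb{R}^d$ is a lattice polytope (all vertices in $\mathbb{Z}^d$) whose vertex set is in general position and whose interior contains no point of $\mathbb{Z}^d$, then $P$ has at most $C\, d^2 (\log d)^3$ vertices.
   Context: A set of points in $\mathbb{R}^d$ is in general position if no $d+1$ of its points lie in a common (affine) hyperplane. *)

theory Defs
  imports Complex_Main
begin

text \<open>Points of R^d are encoded as functions nat => real vanishing at all
  coordinates i >= d (the dimension d varies inside the statement, so a
  type-indexed dimension cannot be used).\<close>

definition Rd :: "nat \<Rightarrow> (nat \<Rightarrow> real) set" where
  "Rd d = {x. \<forall>i\<ge>d. x i = 0}"

definition lattice_point :: "nat \<Rightarrow> (nat \<Rightarrow> real) \<Rightarrow> bool" where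
  "lattice_point d x \<longleftrightarrow> x \<in> Rd d \<and> (\<forall>i<d. x i \<in> \<int>)"

definition conv_hull :: "(nat \<Rightarrow> real) set \<Rightarrow> (nat \<Rightarrow> real) set" where
  "conv_hull V = {x. \<exists>u. (\<forall>v\<in>V. 0 \<le> u v) \<and> (\<Sum>v\<in>V. u v) = 1 \<and>
                        x = (\<lambda>i. \<Sum>v\<in>V. u v * v i)}"

definition vertices :: "(nat \<Rightarrow> real) set \<Rightarrow> (nat \<Rightarrow> real) set" where
  "vertices P = {v \<in> P. \<not> (\<exists>a\<in>P. \<exists>b\<in>P. \<exists>t::real. 0 < t \<and> t < 1 \<and> a \<noteq> b \<and>
                         v = (\<lambda>i. (1 - t) * a i + t * b i))}"

definition interior_d :: "nat \<Rightarrow> (nat \<Rightarrow> real) set \<Rightarrow> (nat \<Rightarrow> real) set" where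
  "interior_d d P = {x \<in> P \<inter> Rd d. \<exists>e>0. \<forall>y\<in>Rd d.
       (\<Sum>i<d. (y i - x i)\<^sup>2) < e\<^sup>2 \<longrightarrow> y \<in> P}"

definition hyperplane_d :: "nat \<Rightarrow> (nat \<Rightarrow> real) set \<Rightarrow> bool" where
  "hyperplane_d d H \<longleftrightarrow> (\<exists>a b. (\<exists>i<d. a i \<noteq> 0) \<and>
       H = {x \<in> Rd d. (\<Sum>i<d. a i * x i) = b})"

definition general_position :: "nat \<Rightarrow> (nat \<Rightarrow> real) set \<Rightarrow> bool" where
  "general_position d S \<longleftrightarrow>
     (\<forall>T\<subseteq>S. card T = d + 1 \<longrightarrow> \<not> (\<exists>H. hyperplane_d d H \<and> T \<subseteq> H))"

end

theory Submission
  imports Defs "HOL-Library.FuncSet" "Jordan_Normal_Form.Determinant"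
begin

text \<open>
  Fix affinely independent vertices \<open>v\<^sub>0, u\<^sub>1, \<dots>, u\<^sub>d\<close> and a large integer \<open>p\<close> coprime to all
  nonzero determinants spanned by the vertices, so that general position persists modulo \<open>p\<close>:
  for \<open>y \<noteq> 0\<close> modulo \<open>p\<close>, each residue is the value \<open>\<langle>y, v\<rangle>\<close> of at most \<open>d\<close> vertices \<open>v\<close>.
  An interior lattice point \<open>v\<^sub>0 + (\<Sum>\<^sub>i b\<^sub>i (u\<^sub>i - v\<^sub>0) + \<Sum>\<^sub>j a\<^sub>j (v\<^sub>j - v\<^sub>0)) / p\<close> exists as soon as the
  numerator can be made divisible by \<open>p\<close> with \<open>b\<^sub>i \<ge> 1\<close>, \<open>a\<^sub>j \<ge> 0\<close> of sum below \<open>p\<close> and vertices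
  \<open>v\<^sub>1, \<dots>, v\<^sub>m\<close>. Solutions are counted with characters modulo \<open>p\<close>. Letting \<open>v\<^sub>j\<close> and \<open>a\<^sub>j < p/(4m)\<close>
  vary, each \<open>j\<close> contributes a factor of relative size at most \<open>1/2\<close> at every \<open>y \<noteq> 0\<close>, provided there
  are at least \<open>512 d m\<close> vertices. Letting \<open>b\<^sub>i - 1\<close> be a sum of two numbers below \<open>p/(8d)\<close>, Parseval
  bounds the remaining sum over all \<open>y\<close> by \<open>(16 d)\<^sup>d\<close> relative to the main term. Hence
  \<open>2\<^sup>m > (16 d)\<^sup>d\<close>, i.e. \<open>m\<close> of order \<open>d log d\<close>, suffices, and a hollow polytope has
  \<open>O(d\<^sup>2 log d)\<close> vertices.
\<close>

subsection \<open>Exponential sums modulo p\<close>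

definition modchar :: "nat \<Rightarrow> int \<Rightarrow> complex" where
  "modchar p t = cis (2 * pi * real_of_int t / real p)"

lemma modchar_0 [simp]: "modchar p 0 = 1"
  by (simp add: modchar_def)

lemma norm_modchar [simp]: "norm (modchar p t) = 1"
  by (simp add: modchar_def)

lemma modchar_add: "modchar p (s + t) = modchar p s * modchar p t"
  by (simp add: modchar_def cis_mult ring_distribs add_divide_distrib)

lemma modchar_sum: "finite I \<Longrightarrow> modchar p (\<Sum>i\<in>I. f i) = (\<Prod>i\<in>I. modchar p (f i))"
  by (induction I rule: finite_induct) (simp_all add: modchar_add)

lemma cnj_modchar: "cnj (modchar p t) = modchar p (- t)"
  by (simp add: modchar_def cis_cnj)

lemma modchar_mult_nat: "modchar p (int a * t) = modchar p t ^ a"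
  unfolding modchar_def DeMoivre by (simp add: mult_ac)

lemma modchar_dvd:
  assumes "int p dvd t"
  shows "modchar p t = 1"
proof (cases "p = 0")
  case False
  obtain q where "t = int p * q"
    using assms by blast
  with False have "modchar p t = cis (2 * pi * real_of_int q)"
    unfolding modchar_def by (intro arg_cong[where f = cis]) simp
  then show ?thesis
    using cis_multiple_2pi[of "real_of_int q"] by simp
qed (use assms in simp)

lemma modchar_mod: "p > 0 \<Longrightarrow> modchar p (t mod int p) = modchar p t"
proof -
  have "modchar p t = modchar p (int p * (t div int p)) * modchar p (t mod int p)"
    by (simp flip: modchar_add)
  then show ?thesis
    by (simp add: modchar_dvd)
qed

text \<open>A crude form of Jordan's inequality. Up to \<open>pi / 3\<close> the cosine is at least
  1/2, so \<open>sin t - t / 2\<close> increases from 0; beyond that the sine is at least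
  \<open>sqrt 3 / 2 > 0.8\<close>, while \<open>x / 3 < 2/3\<close>.\<close>

lemma third_le_sin:
  fixes x :: real
  assumes "0 \<le> x" "x \<le> pi / 2"
  shows "x / 3 \<le> sin x"
proof (cases "x \<le> pi / 3")
  case True
  have "sin 0 - 0 / 2 \<le> sin x - x / 2"
  proof (rule DERIV_nonneg_imp_nondecreasing[OF assms(1)])
    fix y assume y: "0 \<le> y" "y \<le> x"
    have "cos (pi / 3) \<le> cos y"
      using y True assms by (intro cos_monotone_0_pi_le) auto
    then have "0 \<le> cos y - 1 / 2"
      by (simp add: cos_60)
    moreover have "((\<lambda>t. sin t - t / 2) has_real_derivative cos y - 1 / 2) (at y)"
      by (auto intro!: derivative_eq_intros)
    ultimately show "\<exists>D. ((\<lambda>t. sin t - t / 2) has_real_derivative D) (at y) \<and> 0 \<le> D"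
      by blast
  qed
  then show ?thesis using assms by simp
next
  case False
  have "sin (pi / 3) \<le> sin x"
    using False assms by (intro sin_monotone_2pi_le) auto
  moreover have "1.7 \<le> sqrt 3"
    by (rule real_le_rsqrt) (simp add: power2_eq_square)
  ultimately show ?thesis
    using assms pi_less_4 by (simp add: sin_60)
qed

text \<open>With \<open>x = pi * r / p\<close> for the residue \<open>r\<close> of \<open>t\<close>,
  the distance from 1 to the character value is \<open>2 * sin x\<close>. A residue at distance at
  least \<open>k\<close> from the multiples of \<open>p\<close> puts \<open>x\<close> between
  \<open>y = pi * k / p\<close> and \<open>pi - y\<close>, where the sine is at least
  \<open>sin y\<close>.\<close>

lemma norm_one_minus_modchar_ge:
  assumes "k \<ge> 1" "int k \<le> t mod int p" "t mod int p \<le> int p - int k"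
  shows "norm (1 - modchar p t) \<ge> real k / real p"
proof -
  have p: "p > 0" "2 * k \<le> p"
    using assms by (auto intro!: Nat.gr0I)
  define r where "r = real_of_int (t mod int p)"
  have r: "real k \<le> r" "r \<le> real p - real k"
    using assms(2,3) unfolding r_def by linarith+
  define x where "x = pi * r / real p"
  define y where "y = pi * real k / real p"
  have y: "0 \<le> y" "y \<le> pi / 2"
    using p by (auto simp: y_def field_simps)
  have "y \<le> x"
    unfolding x_def y_def using r by (intro divide_right_mono mult_left_mono) auto
  moreover have "pi * (r + real k) / real p \<le> pi * real p / real p"
    using r by (intro divide_right_mono mult_left_mono) auto
  then have "x + y \<le> pi"
    using p by (simp add: x_def y_def distrib_left add_divide_distrib)
  ultimately have yx: "y \<le> x" "x \<le> pi - y"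
    by simp_all
  have "sin y \<le> sin x"
  proof (cases "x \<le> pi / 2")
    case True
    then show ?thesis using y yx by (intro sin_monotone_2pi_le) auto
  next
    case False
    then have "sin y \<le> sin (pi - x)"
      using y yx by (intro sin_monotone_2pi_le) auto
    then show ?thesis by simp
  qed
  with third_le_sin[OF y] have sx: "y / 3 \<le> sin x" by simp
  have "modchar p t = cis (2 * x)"
    using modchar_mod[OF p(1), of t] by (simp add: modchar_def x_def r_def mult_ac)
  moreover have "norm (1 - cis (2 * x)) \<ge> 2 * sin x"
  proof -
    have "1 - cis (2 * x) = complex_of_real (- 2 * sin x) * (\<i> * cis x)"
      by (simp add: complex_eq_iff cos_double_sin sin_double power2_eq_square)
    then have "norm (1 - cis (2 * x)) = \<bar>2 * sin x\<bar>"
      by (simp add: norm_mult)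
    then show ?thesis by linarith
  qed
  \<comment> \<open>Since \<open>pi \<ge> 2\<close>, this gives
    \<open>2 * sin x \<ge> 2 * y / 3 \<ge> 4/3 * k / p\<close>, which leaves room for the crude
    constant 1/3.\<close>
  moreover have "y \<ge> 2 * (real k / real p)"
    using p pi_ge_two unfolding times_divide_eq_right by (auto simp: y_def intro!: divide_right_mono mult_right_mono)
  moreover have "real k / real p \<ge> 0"
    by simp
  ultimately show ?thesis
    using sx by (simp only:)
qed

definition char_sum :: "nat \<Rightarrow> nat \<Rightarrow> int \<Rightarrow> complex" where
  "char_sum p n t = (\<Sum>a<n. modchar p (int a * t))"

lemma norm_char_sum_le: "norm (char_sum p n t) \<le> real n"
  unfolding char_sum_def by (rule order_trans[OF norm_sum]) simp

text \<open>The sum is geometric: multiplied by \<open>1 - modchar p t\<close> it telescopes to a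
  number of modulus at most 2. The bound does not grow with \<open>n\<close>.\<close>

lemma norm_char_sum_le_quotient:
  assumes "k \<ge> 1" "int k \<le> t mod int p" "t mod int p \<le> int p - int k"
  shows "norm (char_sum p n t) \<le> 2 * real p / real k"
proof -
  have p: "p > 0"
    using assms by (auto intro!: Nat.gr0I)
  note ge = norm_one_minus_modchar_ge[OF assms]
  have "(1 - modchar p t) * char_sum p n t = 1 - modchar p t ^ n"
    unfolding char_sum_def modchar_mult_nat by (rule one_diff_power_eq[symmetric])
  then have "norm (1 - modchar p t) * norm (char_sum p n t) = norm (1 - modchar p t ^ n)"
    by (metis norm_mult)
  also have "\<dots> \<le> 2"
    using norm_triangle_ineq4[of 1 "modchar p t ^ n"] by (simp add: norm_power)
  finally have "norm (1 - modchar p t) * norm (char_sum p n t) \<le> 2" .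
  moreover have "(real k / real p) * norm (char_sum p n t)
      \<le> norm (1 - modchar p t) * norm (char_sum p n t)"
    using ge by (rule mult_right_mono) simp
  ultimately have "(real k / real p) * norm (char_sum p n t) \<le> 2"
    by linarith
  then show ?thesis
    using p assms(1) by (simp add: field_simps)
qed

section \<open>Orthogonality of characters and Parseval's identity\<close>

lemma sum_modchar_residues:
  assumes "p > 0"
  shows "(\<Sum>y\<in>{0..<int p}. modchar p (y * t)) = (if int p dvd t then of_nat p else 0)"
proof -
  have eq: "{0..<int p} = int ` {..<p}"
    by (simp add: image_int_atLeastLessThan lessThan_atLeast0)
  have *: "(\<Sum>y\<in>{0..<int p}. modchar p (y * t)) = (\<Sum>a<p. modchar p t ^ a)"
    unfolding eq by (subst sum.reindex) (simp_all add: modchar_mult_nat)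
  show ?thesis
  proof (cases "int p dvd t")
    case True
    then show ?thesis using * by (simp add: modchar_dvd)
  next
    case False
    let ?r = "t mod int p"
    have "?r \<noteq> 0" "0 \<le> ?r" "?r < int p"
      using False assms by (simp_all add: dvd_eq_mod_eq_0)
    then have r: "0 < ?r" "?r < int p"
      by linarith+
    \<comment> \<open>The case \<open>k = 1\<close> of the distance bound shows that the ratio of
      the geometric series is not 1, so the factor \<open>1 - modchar p t\<close> can be
      cancelled.\<close>
    have "norm (1 - modchar p t) \<ge> real 1 / real p"
      using r by (intro norm_one_minus_modchar_ge) auto
    moreover have "real 1 / real p > 0" using assms by simp
    ultimately have ne: "1 - modchar p t \<noteq> 0"
      by (metis norm_zero not_less)
    have "(1 - modchar p t) * (\<Sum>a<p. modchar p t ^ a) = 1 - modchar p t ^ p"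
      by (rule one_diff_power_eq[symmetric])
    also have "modchar p t ^ p = 1"
      using modchar_dvd[of p "int p * t"] by (simp add: modchar_mult_nat)
    finally show ?thesis using ne * False by simp
  qed
qed

lemma parseval_char_sum:
  assumes "p > 0" "n \<le> p"
  shows "(\<Sum>t\<in>{0..<int p}. (norm (char_sum p n t))\<^sup>2) = real p * real n"
proof -
  have "complex_of_real (\<Sum>t\<in>{0..<int p}. (norm (char_sum p n t))\<^sup>2)
      = (\<Sum>t\<in>{0..<int p}. \<Sum>a<n. \<Sum>b<n. modchar p (t * (int a - int b)))"
  proof -
    have "complex_of_real ((norm (char_sum p n t))\<^sup>2)
        = (\<Sum>a<n. \<Sum>b<n. modchar p (t * (int a - int b)))" for t
    proof -
      have "complex_of_real ((norm (char_sum p n t))\<^sup>2) = char_sum p n t * cnj (char_sum p n t)"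
        by (rule complex_norm_square)
      also have "\<dots> = (\<Sum>a<n. \<Sum>b<n. modchar p (int a * t) * modchar p (- (int b * t)))"
        unfolding char_sum_def by (simp add: sum_product cnj_modchar)
      also have "\<dots> = (\<Sum>a<n. \<Sum>b<n. modchar p (t * (int a - int b)))"
        by (simp flip: modchar_add add: algebra_simps)
      finally show ?thesis .
    qed
    then show ?thesis by simp
  qed
  also have "\<dots> = (\<Sum>a<n. \<Sum>b<n. \<Sum>t\<in>{0..<int p}. modchar p (t * (int a - int b)))"
    by (subst sum.swap) (intro sum.cong refl sum.swap)
  also have "\<dots> = (\<Sum>a<n. \<Sum>b<n. if a = b then of_nat p else 0)"
  proof (intro sum.cong refl)
    fix a b assume "a \<in> {..<n}" "b \<in> {..<n}"
    then have "a < p" "b < p" using assms by auto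
    \<comment> \<open>This is where \<open>n \<le> p\<close> matters: distinct summation indices are
      incongruent modulo \<open>p\<close>, so only the diagonal survives.\<close>
    then have "int p dvd int a - int b \<longleftrightarrow> a = b"
      by (metis mod_eq_dvd_iff mod_less of_nat_mod of_nat_eq_iff)
    then show "(\<Sum>t\<in>{0..<int p}. modchar p (t * (int a - int b))) = (if a = b then of_nat p else 0)"
      using sum_modchar_residues[OF assms(1)] by simp
  qed
  also have "\<dots> = complex_of_real (real p * real n)"
    by (simp add: sum.delta)
  finally show ?thesis
    using of_real_eq_iff by blast
qed

section \<open>Character sums in d dimensions\<close>

text \<open>One representative of each class of integer vectors modulo \<open>p\<close>. Extensional
  functions make the set finite and let a sum of products over it factor coordinatewise.\<close>

definition residue_vectors :: "nat \<Rightarrow> nat \<Rightarrow> (nat \<Rightarrow> int) set" where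
  "residue_vectors d p = PiE {..<d} (\<lambda>_. {0..<int p})"

definition dot :: "nat \<Rightarrow> (nat \<Rightarrow> int) \<Rightarrow> (nat \<Rightarrow> int) \<Rightarrow> int" where
  "dot d y x = (\<Sum>i<d. y i * x i)"

lemma finite_residue_vectors [simp]: "finite (residue_vectors d p)"
  by (simp add: residue_vectors_def finite_PiE)

lemma sum_modchar_dot:
  assumes "p > 0"
  shows "(\<Sum>y\<in>residue_vectors d p. modchar p (dot d y x))
    = (if \<forall>i<d. int p dvd x i then of_nat p ^ d else 0)"
proof -
  have "(\<Sum>y\<in>residue_vectors d p. modchar p (dot d y x))
      = (\<Prod>i<d. \<Sum>t\<in>{0..<int p}. modchar p (t * x i))"
    unfolding residue_vectors_def dot_def
    by (subst prod_sum_PiE) (simp_all add: modchar_sum)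
  also have "\<dots> = (\<Prod>i<d. if int p dvd x i then of_nat p else 0)"
    by (simp add: sum_modchar_residues[OF assms])
  also have "\<dots> = (if \<forall>i<d. int p dvd x i then of_nat p ^ d else 0)"
    by (auto intro!: prod_zero)
  finally show ?thesis .
qed

text \<open>Expanding the product gives one character sum for each choice \<open>g\<close>; by
  orthogonality it detects whether \<open>g\<close> solves the congruence with target
  \<open>s\<close>. Without solutions every such sum vanishes.\<close>

lemma char_product_sum_eq_0:
  assumes "p > 0" "finite I" "\<And>i. i \<in> I \<Longrightarrow> finite (Q i)"
    and no: "\<And>g. g \<in> PiE I Q \<Longrightarrow> \<not> (\<forall>c<d. int p dvd (\<Sum>i\<in>I. X i (g i) c) - s c)"
  shows "(\<Sum>y\<in>residue_vectors d p. modchar p (- dot d y s) *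
           (\<Prod>i\<in>I. \<Sum>q\<in>Q i. modchar p (dot d y (X i q)))) = 0"
proof -
  have *: "modchar p (- dot d y s) * (\<Prod>i\<in>I. \<Sum>q\<in>Q i. modchar p (dot d y (X i q)))
     = (\<Sum>g\<in>PiE I Q. modchar p (dot d y (\<lambda>c. (\<Sum>i\<in>I. X i (g i) c) - s c)))" for y
  proof -
    have "modchar p (- dot d y s) * (\<Prod>i\<in>I. \<Sum>q\<in>Q i. modchar p (dot d y (X i q)))
       = (\<Sum>g\<in>PiE I Q. modchar p (- dot d y s + (\<Sum>i\<in>I. dot d y (X i (g i)))))"
      using assms(2,3)
      by (simp add: prod_sum_PiE sum_distrib_left modchar_add modchar_sum del: add_uminus_conv_diff uminus_add_conv_diff)
    moreover have "- dot d y s + (\<Sum>i\<in>I. dot d y (X i (g i)))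
       = dot d y (\<lambda>c. (\<Sum>i\<in>I. X i (g i) c) - s c)" for g
      unfolding dot_def by (subst sum.swap)
        (simp add: right_diff_distrib sum_subtractf sum_distrib_left)
    ultimately show ?thesis by simp
  qed
  have "(\<Sum>y\<in>residue_vectors d p. modchar p (- dot d y s) *
           (\<Prod>i\<in>I. \<Sum>q\<in>Q i. modchar p (dot d y (X i q))))
      = (\<Sum>g\<in>PiE I Q. \<Sum>y\<in>residue_vectors d p.
           modchar p (dot d y (\<lambda>c. (\<Sum>i\<in>I. X i (g i) c) - s c)))"
    unfolding * by (rule sum.swap)
  also have "\<dots> = 0"
    unfolding sum_modchar_dot[OF assms(1)] using no by (intro sum.neutral) auto
  finally show ?thesis .
qed

text \<open>Few elements have a residue close to 0: at most \<open>d\<close> for each of fewer than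
  \<open>2 * k\<close> residues, hence at most a quarter of \<open>X\<close>. They get the trivial
  bound \<open>A\<close>; all others get the geometric bound \<open>2 * p / k \<le> A / 4\<close>.
  Each group contributes at most a quarter of the trivial total.\<close>

lemma norm_sum_char_sum_le:
  fixes X :: "'a set" and f :: "'a \<Rightarrow> int"
  assumes X: "finite X" and k: "k \<ge> 1" and p: "p > 0"
    and res: "\<And>r. card {x \<in> X. f x mod int p = r} \<le> d"
    and kA: "8 * p \<le> k * A" and kd: "8 * k * d \<le> card X"
  shows "norm (\<Sum>x\<in>X. char_sum p A (f x)) \<le> real (card X) * real A / 2"
proof -
  \<comment> \<open>The asymmetric ends leave exactly the residues from \<open>k\<close> to
    \<open>p - k\<close> outside \<open>R\<close>, as the geometric bound requires.\<close>
  define R where "R = {0..<int k} \<union> {int p - int k <..<int p}"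
  define N where "N = {x \<in> X. f x mod int p \<in> R}"
  have "N = (\<Union>r\<in>R. {x \<in> X. f x mod int p = r})"
    unfolding N_def by auto
  then have "card N \<le> (\<Sum>r\<in>R. card {x \<in> X. f x mod int p = r})"
    using card_UN_le[of R] by (simp add: R_def)
  also have "\<dots> \<le> (\<Sum>r\<in>R. d)"
    by (intro sum_mono res)
  also have "\<dots> \<le> (2 * k) * d"
  proof -
    have "card R \<le> k + (k - 1)"
      unfolding R_def by (rule order_trans[OF card_Un_le]) simp
    then have "card R \<le> 2 * k" by linarith
    then show ?thesis by simp
  qed
  finally have N: "4 * card N \<le> card X" using kd by simp
  have out: "norm (char_sum p A (f x)) \<le> real A / 4" if "x \<in> X - N" for x
  proof -
    have "f x mod int p \<notin> R" "0 \<le> f x mod int p" "f x mod int p < int p"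
      using that p by (auto simp: N_def)
    then have "norm (char_sum p A (f x)) \<le> 2 * real p / real k"
      by (intro norm_char_sum_le_quotient k) (auto simp: R_def)
    also have "\<dots> \<le> real A / 4"
    proof -
      have "real (8 * p) \<le> real (k * A)" using kA by (simp only: of_nat_le_iff)
      then show ?thesis using k by (simp add: field_simps)
    qed
    finally show ?thesis .
  qed
  have NX: "N \<subseteq> X" by (auto simp: N_def)
  have "norm (\<Sum>x\<in>X. char_sum p A (f x)) \<le> (\<Sum>x\<in>X. norm (char_sum p A (f x)))"
    by (rule norm_sum)
  also have "\<dots> = (\<Sum>x\<in>X - N. norm (char_sum p A (f x))) + (\<Sum>x\<in>N. norm (char_sum p A (f x)))"
    by (rule sum.subset_diff[OF NX X])
  also have "\<dots> \<le> (\<Sum>x\<in>X - N. real A / 4) + (\<Sum>x\<in>N. real A)"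
    by (intro add_mono sum_mono out norm_char_sum_le)
  also have "\<dots> \<le> real (card X) * (real A / 4) + (real (card X) / 4) * real A"
  proof -
    have "real (card (X - N)) \<le> real (card X)"
      using X by (simp add: card_mono)
    moreover have "real (card N) \<le> real (card X) / 4"
      using N by linarith
    ultimately show ?thesis
      unfolding sum_constant by (intro add_mono mult_right_mono) auto
  qed
  also have "\<dots> = real (card X) * real A / 2" by simp
  finally show ?thesis .
qed

text \<open>By \<open>inj\<close>, applied to differences, a residue vector is determined by its
  products with the \<open>w i\<close> modulo \<open>p\<close>. Using these as new coordinates
  bounds the sum by one over all residue vectors, which factors into \<open>d\<close> copies of
  Parseval's identity.\<close>

lemma sum_prod_norm_char_sum_le:
  fixes w :: "nat \<Rightarrow> nat \<Rightarrow> int"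
  assumes p: "p > 0" and B: "B \<le> p"
    and inj: "\<And>y. (\<forall>i<d. int p dvd dot d y (w i)) \<Longrightarrow> \<forall>i<d. int p dvd y i"
  shows "(\<Sum>y\<in>residue_vectors d p. \<Prod>i<d. (norm (char_sum p B (dot d y (w i))))\<^sup>2)
    \<le> (real p * real B) ^ d"
proof -
  define h where "h y = restrict (\<lambda>i. dot d y (w i) mod int p) {..<d}" for y
  have cm: "char_sum p B (t mod int p) = char_sum p B t" for t
    unfolding char_sum_def modchar_mult_nat by (simp add: modchar_mod p)
  have "inj_on h (residue_vectors d p)"
  proof (rule inj_onI)
    fix y z assume y: "y \<in> residue_vectors d p" and z: "z \<in> residue_vectors d p" and "h y = h z"
    have "dot d y (w i) mod int p = dot d z (w i) mod int p" if "i < d" for i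
    proof -
      have "h y i = h z i"
        using \<open>h y = h z\<close> by simp
      with that show ?thesis
        by (simp add: h_def)
    qed
    then have "\<forall>i<d. int p dvd dot d (\<lambda>j. y j - z j) (w i)"
      by (simp add: mod_eq_dvd_iff dot_def left_diff_distrib sum_subtractf)
    from inj[OF this] have "y i mod int p = z i mod int p" if "i < d" for i
      using that by (simp add: mod_eq_dvd_iff)
    moreover have "y i mod int p = y i" "z i mod int p = z i" if "i < d" for i
      using y z that unfolding residue_vectors_def by (fastforce simp: PiE_iff)+
    ultimately show "y = z"
      using y z unfolding residue_vectors_def by (intro PiE_ext) auto
  qed
  then have "(\<Sum>y\<in>residue_vectors d p. \<Prod>i<d. (norm (char_sum p B (dot d y (w i))))\<^sup>2)
      = (\<Sum>t\<in>h ` residue_vectors d p. \<Prod>i<d. (norm (char_sum p B (t i)))\<^sup>2)"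
    by (subst sum.reindex) (simp_all add: h_def cm)
  also have "\<dots> \<le> (\<Sum>t\<in>residue_vectors d p. \<Prod>i<d. (norm (char_sum p B (t i)))\<^sup>2)"
  proof (rule sum_mono2)
    have "h y \<in> residue_vectors d p" for y
      unfolding h_def residue_vectors_def using p by (intro restrict_PiE_iff[THEN iffD2]) simp
    then show "h ` residue_vectors d p \<subseteq> residue_vectors d p"
      by blast
  qed (simp_all add: prod_nonneg)
  also have "\<dots> = (\<Prod>i<d. \<Sum>t\<in>{0..<int p}. (norm (char_sum p B t))\<^sup>2)"
    unfolding residue_vectors_def by (subst prod_sum_PiE) simp_all
  also have "\<dots> = (real p * real B) ^ d"
    by (simp add: parseval_char_sum[OF p B])
  finally show ?thesis .
qed

subsection \<open>Counting solutions of a vector congruence\<close>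

lemma prod_lessThan_add:
  "(\<Prod>i<a + n. F i) = (\<Prod>i<a. F i) * (\<Prod>i<n. F (a + i :: nat))"
  for F :: "nat \<Rightarrow> 'a :: comm_monoid_mult"
  by (induction n) (simp_all add: mult_ac)

text \<open>Each \<open>u i\<close> fills two slots with coefficients below \<open>B\<close>, so
  that its character sum enters squared and Parseval applies; the other \<open>m\<close> slots hold
  any element of \<open>X\<close> with a coefficient below \<open>A\<close>. If no solution existed,
  the term at 0, of size \<open>B ^ (2 * d) * (n * A) ^ m\<close>, would be cancelled by terms whose
  total is at most \<open>(p * B) ^ d * (n * A / 2) ^ m\<close>, which \<open>pB\<close>
  forbids.\<close>

lemma exists_combination_mod:
  fixes X :: "'a set" and f :: "'a \<Rightarrow> nat \<Rightarrow> int" and u :: "nat \<Rightarrow> 'a"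
  assumes X: "finite X" and k: "k \<ge> 1" and p: "p > 0" and B: "B \<le> p"
    and res: "\<And>y r. \<exists>i<d. \<not> int p dvd y i \<Longrightarrow> card {x \<in> X. dot d y (f x) mod int p = r} \<le> d"
    and basis: "\<And>y. \<forall>i<d. int p dvd dot d y (f (u i)) \<Longrightarrow> \<forall>i<d. int p dvd y i"
    and kA: "8 * p \<le> k * A" and kd: "8 * k * d \<le> card X" and X0: "X \<noteq> {}"
    and pB: "p ^ d < B ^ d * 2 ^ m"
  defines "Q \<equiv> \<lambda>i. (if i < d then {u i} else if i < d + d then {u (i - d)} else X)
                   \<times> {..<(if i < d + d then B else A)}"
  shows "\<exists>g\<in>PiE {..<d + d + m} Q. \<forall>c<d. int p dvd
           (\<Sum>i<d + d + m. int (snd (g i)) * f (fst (g i)) c) - s c"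
proof (rule ccontr)
  assume no: "\<not> ?thesis"
  define n where "n = card X"
  define Y where "Y = residue_vectors d p"
  define Phi where "Phi y = (\<Sum>x\<in>X. char_sum p A (dot d y (f x)))" for y
  define K where "K y = (\<Prod>i<d. char_sum p B (dot d y (f (u i))))" for y
  define G where "G y = modchar p (- dot d y s) * ((K y)\<^sup>2 * Phi y ^ m)" for y
  have dot_scale: "dot d y (\<lambda>c. a * x c) = a * dot d y x" for y a x
    by (simp add: dot_def sum_distrib_left mult_ac)
  have finQ: "finite (Q i)" for i
    using X by (simp add: Q_def)
  have "(\<Sum>y\<in>Y. modchar p (- dot d y s) *
      (\<Prod>i<d + d + m. \<Sum>q\<in>Q i. modchar p (dot d y (\<lambda>c. int (snd q) * f (fst q) c)))) = 0"
    unfolding Y_def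
    by (rule char_product_sum_eq_0[where X = "\<lambda>i q c. int (snd q) * f (fst q) c"])
       (use p finQ no in auto)
  moreover have "(\<Prod>i<d + d + m. \<Sum>q\<in>Q i. modchar p (dot d y (\<lambda>c. int (snd q) * f (fst q) c)))
      = (K y)\<^sup>2 * Phi y ^ m" for y
  proof -
    have "(\<Sum>q\<in>U \<times> {..<b}. modchar p (dot d y (\<lambda>c. int (snd q) * f (fst q) c)))
        = (\<Sum>x\<in>U. char_sum p b (dot d y (f x)))" for U b
      by (simp add: dot_scale char_sum_def sum.cartesian_product split_def)
    then show ?thesis
      by (simp add: prod_lessThan_add Q_def K_def Phi_def power2_eq_square)
  qed
  ultimately have zero: "(\<Sum>y\<in>Y. G y) = 0"
    by (simp add: G_def)
  \<comment> \<open>The zero vector in its extensional representation; its term is the main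
    term.\<close>
  define y0 where "y0 = restrict (\<lambda>_. 0 :: int) {..<d}"
  have y0: "y0 \<in> Y"
    using p by (auto simp: y0_def Y_def residue_vectors_def)
  have finY: "finite Y"
    by (simp add: Y_def)
  have "dot d y0 x = 0" for x
    by (simp add: dot_def y0_def)
  then have Go: "G y0 = of_nat ((B ^ d)\<^sup>2 * (n * A) ^ m)"
    by (simp add: G_def K_def Phi_def n_def char_sum_def)
  have "G y0 = - (\<Sum>y\<in>Y - {y0}. G y)"
    using zero sum.remove[OF finY y0, of G] by (simp add: eq_neg_iff_add_eq_0)
  then have "norm (G y0) \<le> (\<Sum>y\<in>Y - {y0}. norm (G y))"
    using norm_sum[of G "Y - {y0}"] by simp
  also have "\<dots> \<le> (\<Sum>y\<in>Y - {y0}. (norm (K y))\<^sup>2 * (real n * real A / 2) ^ m)"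
  proof (rule sum_mono)
    fix y assume y: "y \<in> Y - {y0}"
    have "\<exists>i<d. \<not> int p dvd y i"
    proof (rule ccontr)
      assume all: "\<not> ?thesis"
      have "y i = y0 i" if "i \<in> {..<d}" for i
      proof -
        have "0 \<le> y i" "y i < int p"
          using y that by (auto simp: Y_def residue_vectors_def PiE_iff)
        moreover have "int p dvd y i"
          using all that by auto
        ultimately have "y i = 0"
          by (metis order_less_le zdvd_not_zless)
        then show ?thesis
          using that by (simp add: y0_def)
      qed
      moreover have "y \<in> PiE {..<d} (\<lambda>_. {0..<int p})" "y0 \<in> PiE {..<d} (\<lambda>_. {0..<int p})"
        using y y0 by (auto simp: Y_def residue_vectors_def)
      ultimately have "y = y0"
        by (intro PiE_ext)
      then show False using y by simp
    qed
    then have "norm (Phi y) \<le> real n * real A / 2"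
      unfolding Phi_def n_def
      by (intro norm_sum_char_sum_le[where k = k and d = d] X k p kA kd res)
    then have "norm (Phi y) ^ m \<le> (real n * real A / 2) ^ m"
      by (intro power_mono) auto
    then show "norm (G y) \<le> (norm (K y))\<^sup>2 * (real n * real A / 2) ^ m"
      by (simp add: G_def norm_mult norm_power mult_left_mono)
  qed
  also have "\<dots> \<le> (\<Sum>y\<in>Y. (norm (K y))\<^sup>2 * (real n * real A / 2) ^ m)"
    using finY by (intro sum_mono2) auto
  also have "\<dots> = (\<Sum>y\<in>Y. (norm (K y))\<^sup>2) * (real n * real A / 2) ^ m"
    by (simp add: sum_distrib_right)
  also have "\<dots> \<le> (real p * real B) ^ d * (real n * real A / 2) ^ m"
  proof (rule mult_right_mono)
    show "(\<Sum>y\<in>Y. (norm (K y))\<^sup>2) \<le> (real p * real B) ^ d"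
      using sum_prod_norm_char_sum_le[OF p B basis]
      unfolding K_def Y_def by (simp add: prod_norm[symmetric] prod_power_distrib)
  qed simp
  also have "\<dots> = real (p ^ d) * real B ^ d * (real n * real A) ^ m / 2 ^ m"
    by (simp add: power_mult_distrib power_divide)
  \<comment> \<open>The factors common to both sides must be positive for the strict inequality
    \<open>pB\<close> to survive the multiplication.\<close>
  also have "\<dots> < real (B ^ d * 2 ^ m) * real B ^ d * (real n * real A) ^ m / 2 ^ m"
  proof -
    have "real (p ^ d) < real (B ^ d * 2 ^ m)"
      using pB by (simp only: of_nat_less_iff)
    moreover have "0 < real B ^ d"
    proof -
      have "B ^ d \<noteq> 0" using pB by (intro notI) simp
      then show ?thesis by simp
    qed
    moreover have "0 < (real n * real A) ^ m"
    proof -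
      have "A \<noteq> 0" using p kA by (intro notI) simp
      moreover have "n \<noteq> 0" using X X0 by (simp add: n_def)
      ultimately show ?thesis by simp
    qed
    ultimately show ?thesis
      by (intro divide_strict_right_mono mult_strict_right_mono) auto
  qed
  also have "\<dots> = norm (G y0)"
    unfolding Go norm_of_nat by (simp add: power2_eq_square power_mult_distrib)
  finally show False by simp
qed

subsection \<open>Lattice polytopes\<close>

text \<open>By hypothesis the matrix of the \<open>w i\<close> has nonzero determinant
  \<open>D\<close>, and its adjugate \<open>N\<close> inverts it up to the factor \<open>D\<close>.
  Staying in the integers allows reduction modulo any \<open>q\<close>.\<close>

lemma int_left_inverse:
  fixes w :: "nat \<Rightarrow> nat \<Rightarrow> int"
  assumes "\<And>a. \<forall>i<d. dot d a (w i) = 0 \<Longrightarrow> \<forall>j<d. a j = 0"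
  obtains N D where "D \<noteq> 0"
    "\<And>i j. i < d \<Longrightarrow> j < d \<Longrightarrow> (\<Sum>k<d. N i k * w k j) = (if i = j then D else 0)"
proof -
  define M where "M = mat d d (\<lambda>(i, j). w i j)"
  have M: "M \<in> carrier_mat d d" by (simp add: M_def)
  have "det M \<noteq> 0"
  proof
    assume "det M = 0"
    then obtain v where v: "v \<in> carrier_vec d" "v \<noteq> 0\<^sub>v d" "M *\<^sub>v v = 0\<^sub>v d"
      using det_0_iff_vec_prod_zero[OF M] by blast
    have "dot d (\<lambda>j. v $ j) (w i) = 0" if "i < d" for i
    proof -
      have "(M *\<^sub>v v) $ i = 0" using v that by simp
      then show ?thesis
        using v that by (simp add: M_def dot_def scalar_prod_def lessThan_atLeast0 mult.commute)
    qed
    then have "\<forall>j<d. v $ j = 0"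
      using assms by blast
    then have "v = 0\<^sub>v d" using v by (intro eq_vecI) auto
    then show False using v by simp
  qed
  moreover have "(\<Sum>k<d. adj_mat M $$ (i, k) * w k j) = (if i = j then det M else 0)"
    if "i < d" "j < d" for i j
  proof -
    have "(adj_mat M * M) $$ (i, j) = (det M \<cdot>\<^sub>m 1\<^sub>m d) $$ (i, j)"
      using adj_mat(3)[OF M] by simp
    moreover have "adj_mat M \<in> carrier_mat d d" using adj_mat(1)[OF M] .
    ultimately show ?thesis
      using that by (auto simp: M_def scalar_prod_def lessThan_atLeast0 split: if_splits)
  qed
  ultimately show ?thesis
    by (rule that)
qed

section \<open>Convex hulls, vertices and interior points\<close>

lemma conv_hull_mono:
  assumes "finite V" "S \<subseteq> V"
  shows "conv_hull S \<subseteq> conv_hull V"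
proof
  fix x assume "x \<in> conv_hull S"
  then obtain u where u: "\<forall>v\<in>S. 0 \<le> u v" "(\<Sum>v\<in>S. u v) = 1" "x = (\<lambda>i. \<Sum>v\<in>S. u v * v i)"
    unfolding conv_hull_def by blast
  define u' where "u' v = (if v \<in> S then u v else 0)" for v
  have "(\<Sum>v\<in>V. u' v * F v) = (\<Sum>v\<in>S. u v * F v)" for F :: "_ \<Rightarrow> real"
    using assms by (intro sum.mono_neutral_cong_right) (auto simp: u'_def)
  from this[of "\<lambda>_. 1"] this have "(\<Sum>v\<in>V. u' v) = 1" "x = (\<lambda>i. \<Sum>v\<in>V. u' v * v i)"
    using u by auto
  moreover have "\<forall>v\<in>V. 0 \<le> u' v" using u by (simp add: u'_def)
  ultimately show "x \<in> conv_hull V"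
    unfolding conv_hull_def by blast
qed

lemma interior_d_mono: "P \<subseteq> P' \<Longrightarrow> interior_d d P \<subseteq> interior_d d P'"
  unfolding interior_d_def by blast

text \<open>If a hull point outside \<open>V\<close> gives positive weight \<open>t\<close> to some
  \<open>a\<close> in \<open>V\<close>, then \<open>t < 1\<close>, and the point lies strictly
  between \<open>a\<close> and the renormalised combination \<open>b\<close> of the rest; so it is
  not extreme.\<close>

lemma vertices_conv_hull_subset:
  assumes "finite V"
  shows "vertices (conv_hull V) \<subseteq> V"
proof (rule ccontr)
  assume "\<not> ?thesis"
  then obtain v where v: "v \<in> vertices (conv_hull V)" "v \<notin> V" by blast
  then have "v \<in> conv_hull V" by (simp add: vertices_def)
  then obtain u where u: "\<forall>w\<in>V. 0 \<le> u w" "(\<Sum>w\<in>V. u w) = 1" "v = (\<lambda>i. \<Sum>w\<in>V. u w * w i)"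
    unfolding conv_hull_def by blast
  have "\<exists>w\<in>V. u w \<noteq> 0"
    using u(2) by (metis sum.neutral zero_neq_one)
  then obtain a where a: "a \<in> V" "u a > 0"
    using u(1) by (metis order_less_le)
  define t where "t = u a"
  have split: "(\<Sum>w\<in>V. u w * F w) = t * F a + (\<Sum>w\<in>V - {a}. u w * F w)" for F :: "_ \<Rightarrow> real"
    unfolding t_def using assms a by (simp add: sum.remove)
  have rest: "(\<Sum>w\<in>V - {a}. u w) = 1 - t"
    using split[of "\<lambda>_. 1"] u(2) by simp
  have "t \<noteq> 1"
  proof
    assume "t = 1"
    then have "\<forall>w\<in>V - {a}. u w = 0"
      using rest u(1) assms sum_nonneg_eq_0_iff[of "V - {a}" u] by simp
    then have "v = a"
      using u(3) split \<open>t = 1\<close> by simp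
    then show False using v a by simp
  qed
  moreover have "1 - t \<ge> 0"
    unfolding rest[symmetric] using u(1) by (intro sum_nonneg) auto
  ultimately have t: "0 < t" "t < 1" using a by (auto simp: t_def)
  define b where "b = (\<lambda>i. \<Sum>w\<in>V - {a}. u w / (1 - t) * w i)"
  have "b \<in> conv_hull (V - {a})"
    unfolding conv_hull_def b_def
    using t u(1) rest by (auto simp flip: sum_divide_distrib intro!: exI[of _ "\<lambda>w. u w / (1 - t)"])
  then have b: "b \<in> conv_hull V"
    using conv_hull_mono[OF assms, of "V - {a}"] by blast
  have "a \<in> conv_hull {a}"
    unfolding conv_hull_def by (auto intro!: exI[of _ "\<lambda>_. 1"])
  then have a': "a \<in> conv_hull V"
    using conv_hull_mono[OF assms, of "{a}"] a by blast
  have eq: "v = (\<lambda>i. (1 - t) * b i + t * a i)"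
  proof
    fix i
    have "(1 - t) * b i = (\<Sum>w\<in>V - {a}. u w * w i)"
      unfolding b_def sum_distrib_left using t by (intro sum.cong) auto
    then show "v i = (1 - t) * b i + t * a i"
      using split[of "\<lambda>w. w i"] u(3) by simp
  qed
  have "b \<noteq> a"
  proof
    assume "b = a"
    then have "v = a" unfolding eq by (auto simp: algebra_simps)
    then show False using v a by simp
  qed
  with v(1) a' b t eq show False
    unfolding vertices_def by blast
qed

text \<open>A small displacement can be absorbed by changing the weights of the \<open>h i\<close>.
  The left inverse \<open>R\<close> turns it into small coefficients on the differences
  \<open>h i - h d\<close>, and positive weights there leave room for the change.\<close>

lemma positive_weights_interior:
  fixes h :: "nat \<Rightarrow> nat \<Rightarrow> real" and W :: "(nat \<Rightarrow> real) \<Rightarrow> real"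
  assumes S: "finite S" "S \<subseteq> Rd d" and h: "h ` {..d} \<subseteq> S"
    and R: "\<And>i j. i < d \<Longrightarrow> j < d \<Longrightarrow>
        (\<Sum>k<d. R i k * (h k j - h d j)) = (if i = j then 1 else 0)"
    and W: "\<And>v. v \<in> S \<Longrightarrow> 0 \<le> W v" "(\<Sum>v\<in>S. W v) = 1" "\<And>i. i \<le> d \<Longrightarrow> 0 < W (h i)"
  shows "(\<lambda>l. \<Sum>v\<in>S. W v * v l) \<in> interior_d d (conv_hull S)"
proof -
  define z where "z = (\<lambda>l. \<Sum>v\<in>S. W v * v l)"
  have z: "z \<in> conv_hull S"
    unfolding conv_hull_def z_def using W by blast
  have S0: "v l = 0" if "v \<in> S" "l \<ge> d" for v l
    using S(2) that by (auto simp: Rd_def)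
  have zRd: "z \<in> Rd d"
    unfolding Rd_def z_def using S0 by (auto intro!: sum.neutral)
  define c0 where "c0 = Min ((\<lambda>i. W (h i)) ` {..d})"
  have c0: "c0 > 0" "\<And>i. i \<le> d \<Longrightarrow> c0 \<le> W (h i)"
    unfolding c0_def using W(3) by (auto intro: Min_le)
  define K where "K = (\<Sum>i<d. \<Sum>j<d. \<bar>R j i\<bar>)"
  have K: "K \<ge> 0" by (simp add: K_def sum_nonneg)
  \<comment> \<open>The summand 1 avoids division by zero; all that is used of \<open>e\<close> is
    \<open>e > 0\<close> and \<open>e * K \<le> c0\<close>, with \<open>c0\<close> the least weight
    on the \<open>h i\<close>.\<close>
  define e where "e = c0 / (K + 1)"
  have e: "e > 0" "e * K \<le> c0"
    using c0 K by (auto simp: e_def field_simps)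
  have "y \<in> conv_hull S" if y: "y \<in> Rd d" and dist: "(\<Sum>i<d. (y i - z i)\<^sup>2) < e\<^sup>2" for y
  proof -
    have small: "\<bar>y j - z j\<bar> \<le> e" if "j < d" for j
    proof -
      have "(y j - z j)\<^sup>2 \<le> (\<Sum>i<d. (y i - z i)\<^sup>2)"
        using that by (intro member_le_sum) auto
      then have "(y j - z j)\<^sup>2 \<le> e\<^sup>2" using dist by simp
      then show ?thesis using e by (simp add: abs_le_square_iff[symmetric])
    qed
    define c where "c i = (\<Sum>j<d. (y j - z j) * R j i)" for i
    have "(\<Sum>i<d. \<bar>c i\<bar>) \<le> (\<Sum>i<d. \<Sum>j<d. e * \<bar>R j i\<bar>)"
      unfolding c_def
      by (intro sum_mono order_trans[OF sum_abs]) (auto simp: abs_mult intro!: mult_right_mono small)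
    also have "\<dots> = e * K" by (simp add: K_def sum_distrib_left)
    finally have c: "(\<Sum>i<d. \<bar>c i\<bar>) \<le> c0" using e by simp
    \<comment> \<open>Mass \<open>c i\<close> moves from \<open>h d\<close> to \<open>h i\<close>.
      The total stays 1, and each weight on the \<open>h i\<close> changes by at most the sum of the
      absolute values of \<open>c\<close>.\<close>
    define W' where "W' v = W v + (\<Sum>i<d. c i * (of_bool (v = h i) - of_bool (v = h d)))" for v
    have "0 \<le> W' v" if v: "v \<in> S" for v
    proof (cases "v \<in> h ` {..d}")
      case True
      then obtain l where "l \<le> d" "v = h l" by auto
      then have "c0 \<le> W v" using c0 by simp
      moreover have "\<bar>\<Sum>i<d. c i * (of_bool (v = h i) - of_bool (v = h d))\<bar> \<le> (\<Sum>i<d. \<bar>c i\<bar>)"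
        by (intro order_trans[OF sum_abs] sum_mono) (auto simp: abs_mult)
      ultimately show ?thesis using c unfolding W'_def by linarith
    next
      case False
      then have "v \<noteq> h i" if "i \<le> d" for i using that by auto
      then have "W' v = W v" by (simp add: W'_def)
      then show ?thesis using W v by simp
    qed
    moreover have comb: "(\<Sum>v\<in>S. W' v * F v) = (\<Sum>v\<in>S. W v * F v) + (\<Sum>i<d. c i * (F (h i) - F (h d)))"
      for F :: "_ \<Rightarrow> real"
    proof -
      have pick: "(\<Sum>v\<in>S. of_bool (v = h i) * F v) = F (h i)" if "i \<le> d" for i
        using S(1) h that by (simp add: of_bool_def if_distrib if_distribR image_subset_iff sum.delta cong: if_cong)
      have "(\<Sum>v\<in>S. W' v * F v) = (\<Sum>v\<in>S. W v * F v)
          + (\<Sum>v\<in>S. \<Sum>i<d. c i * (of_bool (v = h i) * F v - of_bool (v = h d) * F v))"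
        unfolding W'_def distrib_right sum.distrib sum_distrib_right by (simp add: algebra_simps)
      also have "(\<Sum>v\<in>S. \<Sum>i<d. c i * (of_bool (v = h i) * F v - of_bool (v = h d) * F v))
          = (\<Sum>i<d. c i * ((\<Sum>v\<in>S. of_bool (v = h i) * F v) - (\<Sum>v\<in>S. of_bool (v = h d) * F v)))"
        by (subst sum.swap) (simp only: sum_distrib_left sum_subtractf right_diff_distrib)
      also have "\<dots> = (\<Sum>i<d. c i * (F (h i) - F (h d)))"
        by (intro sum.cong refl) (simp add: pick)
      finally show ?thesis .
    qed
    moreover have "(\<Sum>v\<in>S. W' v) = 1"
      using comb[of "\<lambda>_. 1"] W(2) by simp
    moreover have "y = (\<lambda>l. \<Sum>v\<in>S. W' v * v l)"
    proof
      fix l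
      show "y l = (\<Sum>v\<in>S. W' v * v l)"
      proof (cases "l < d")
        case True
        have "(\<Sum>i<d. c i * (h i l - h d l)) = (\<Sum>i<d. \<Sum>j<d. (y j - z j) * (R j i * (h i l - h d l)))"
          by (simp add: c_def sum_distrib_right mult.assoc)
        also have "\<dots> = (\<Sum>j<d. (y j - z j) * (\<Sum>i<d. R j i * (h i l - h d l)))"
          by (subst sum.swap) (simp add: sum_distrib_left)
        also have "\<dots> = (\<Sum>j<d. (y j - z j) * (if j = l then 1 else 0))"
          using True by (intro sum.cong refl) (simp add: R)
        also have "\<dots> = y l - z l"
          using True by (simp add: if_distrib sum.delta cong: if_cong)
        finally show ?thesis
          by (simp add: comb z_def)
      next
        case False
        then show ?thesis
          using y by (auto simp: Rd_def S0 intro!: sum.neutral[symmetric])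
      qed
    qed
    ultimately show ?thesis
      unfolding conv_hull_def by blast
  qed
  then show ?thesis
    using z zRd e(1) unfolding interior_d_def z_def[symmetric] by blast
qed

section \<open>General position over the integers and modulo q\<close>

definition int_vec :: "(nat \<Rightarrow> real) \<Rightarrow> nat \<Rightarrow> int" where
  "int_vec v i = \<lfloor>v i\<rfloor>"

lemma real_int_vec: "lattice_point d v \<Longrightarrow> real_of_int (int_vec v i) = v i"
proof -
  assume "lattice_point d v"
  then have "v i \<in> \<int>"
    by (cases "i < d") (auto simp: lattice_point_def Rd_def)
  then show ?thesis
    by (auto simp: int_vec_def elim: Ints_cases)
qed

text \<open>A nonzero integer vector orthogonal to all differences from \<open>h d\<close> would be
  the normal of a hyperplane through \<open>d + 1\<close> points of \<open>S\<close>.\<close>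

lemma general_position_left_inverse:
  assumes S: "\<And>v. v \<in> S \<Longrightarrow> lattice_point d v" and gp: "general_position d S"
    and h: "inj_on h {..d}" "h ` {..d} \<subseteq> S"
  obtains N D where "D \<noteq> 0" "\<And>i j. i < d \<Longrightarrow> j < d \<Longrightarrow>
    (\<Sum>k<d. N i k * (int_vec (h k) j - int_vec (h d) j)) = (if i = j then D else 0)"
proof (rule int_left_inverse[of d "\<lambda>k j. int_vec (h k) j - int_vec (h d) j"])
  fix a assume a: "\<forall>i<d. dot d a (\<lambda>j. int_vec (h i) j - int_vec (h d) j) = 0"
  show "\<forall>j<d. a j = 0"
  proof (rule ccontr)
    assume "\<not> ?thesis"
    then have nz: "\<exists>i<d. real_of_int (a i) \<noteq> 0" by auto
    define H where "H = {x \<in> Rd d. (\<Sum>i<d. real_of_int (a i) * x i) = real_of_int (dot d a (int_vec (h d)))}"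
    have "hyperplane_d d H"
      unfolding hyperplane_d_def H_def
      by (rule exI[of _ "\<lambda>i. real_of_int (a i)"], rule exI, rule conjI, rule nz, rule refl)
    moreover have "h ` {..d} \<subseteq> H"
    proof
      fix x assume "x \<in> h ` {..d}"
      then obtain i where i: "i \<le> d" "x = h i" by auto
      then have x: "lattice_point d x" using h S by auto
      have "dot d a (int_vec x) = dot d a (int_vec (h d))"
      proof (cases "i = d")
        case False
        then have "dot d a (\<lambda>j. int_vec (h i) j - int_vec (h d) j) = 0" using a i by simp
        then show ?thesis
          using i by (simp add: dot_def right_diff_distrib sum_subtractf)
      qed (use i in simp)
      moreover have "(\<Sum>i<d. real_of_int (a i) * x i) = real_of_int (dot d a (int_vec x))"
        by (simp add: dot_def real_int_vec[OF x])
      ultimately show "x \<in> H"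
        using x by (simp add: H_def lattice_point_def)
    qed
    moreover have "card (h ` {..d}) = d + 1"
      using h(1) by (simp add: card_image)
    ultimately show False
      using gp h(2) unfolding general_position_def by blast
  qed
qed (rule that)

text \<open>If \<open>d + 1\<close> points share a value of \<open>y\<close> modulo
  \<open>q\<close>, then \<open>q\<close> divides \<open>y\<close> on their differences. The
  integral left inverse yields that \<open>q\<close> divides the determinant times each
  \<open>y i\<close>, and coprimality removes the determinant.\<close>

lemma general_position_mod:
  assumes fin: "finite S" and S: "\<And>v. v \<in> S \<Longrightarrow> lattice_point d v" and gp: "general_position d S"
  obtains D :: nat where "D > 0"
    "\<And>q y r. coprime q (int D) \<Longrightarrow> \<exists>i<d. \<not> q dvd y i \<Longrightarrow>
       card {v \<in> S. dot d y (int_vec v) mod q = r} \<le> d"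
proof -
  define TT where "TT = {T. T \<subseteq> S \<and> card T = d + 1}"
  have finTT: "finite TT" using fin by (simp add: TT_def)
  have "\<exists>D. D \<noteq> 0 \<and> (\<forall>q y r. (\<forall>v\<in>T. dot d y (int_vec v) mod q = r) \<longrightarrow> (\<forall>i<d. q dvd D * y i))"
    if T: "T \<in> TT" for T
  proof -
    have "card {..d} = card T" "finite T"
      using T fin by (auto simp: TT_def intro: finite_subset)
    then obtain h where h: "bij_betw h {..d} T"
      using finite_same_card_bij[of "{..d}" T] by auto
    then have inj: "inj_on h {..d}" "h ` {..d} \<subseteq> S"
      using T by (auto simp: bij_betw_def TT_def)
    obtain N D where D: "D \<noteq> 0" and N: "\<And>i j. i < d \<Longrightarrow> j < d \<Longrightarrow>
        (\<Sum>k<d. N i k * (int_vec (h k) j - int_vec (h d) j)) = (if i = j then D else 0)"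
      by (rule general_position_left_inverse[OF _ gp inj], erule S, rule that)
    have "q dvd D * y i" if eq: "\<forall>v\<in>T. dot d y (int_vec v) mod q = r" and i: "i < d" for q y r i
    proof -
      have "q dvd dot d y (\<lambda>j. int_vec (h k) j - int_vec (h d) j)" if "k < d" for k
      proof -
        have "h k \<in> T" "h d \<in> T" using h that by (auto simp: bij_betw_def)
        then have "dot d y (int_vec (h k)) mod q = dot d y (int_vec (h d)) mod q"
          using eq by simp
        then show ?thesis
          by (simp add: mod_eq_dvd_iff dot_def right_diff_distrib sum_subtractf)
      qed
      then have "q dvd (\<Sum>k<d. N i k * dot d y (\<lambda>j. int_vec (h k) j - int_vec (h d) j))"
        by (intro dvd_sum dvd_mult) auto
      also have "\<dots> = (\<Sum>j<d. y j * (\<Sum>k<d. N i k * (int_vec (h k) j - int_vec (h d) j)))"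
        unfolding dot_def sum_distrib_left by (subst sum.swap) (simp add: mult_ac)
      also have "\<dots> = (\<Sum>j<d. y j * (if i = j then D else 0))"
        using i by (intro sum.cong refl) (simp add: N)
      also have "\<dots> = D * y i"
        using i by (simp add: if_distrib sum.delta mult.commute cong: if_cong)
      finally show ?thesis .
    qed
    then show ?thesis using D by blast
  qed
  then obtain E where E: "\<And>T. T \<in> TT \<Longrightarrow> E T \<noteq> 0"
    "\<And>T q y r. T \<in> TT \<Longrightarrow> \<forall>v\<in>T. dot d y (int_vec v) mod q = r \<Longrightarrow> \<forall>i<d. q dvd E T * y i"
    by metis
  \<comment> \<open>One modulus condition serves all subsets of size \<open>d + 1\<close>: their
    determinants all divide this product.\<close>
  define D where "D = nat \<bar>\<Prod>T\<in>TT. E T\<bar>"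
  show ?thesis
  proof (rule that)
    show "D > 0" using E(1) finTT by (simp add: D_def)
    fix q r :: int and y :: "nat \<Rightarrow> int"
    assume cop: "coprime q (int D)" and y: "\<exists>i<d. \<not> q dvd y i"
    show "card {v \<in> S. dot d y (int_vec v) mod q = r} \<le> d"
    proof (rule ccontr)
      assume "\<not> ?thesis"
      then have "d + 1 \<le> card {v \<in> S. dot d y (int_vec v) mod q = r}" by simp
      then obtain T where T: "T \<subseteq> {v \<in> S. dot d y (int_vec v) mod q = r}" "card T = d + 1"
        by (rule obtain_subset_with_card_n) (rule that)
      then have TT: "T \<in> TT" by (auto simp: TT_def)
      have "E T dvd int D" using TT finTT by (simp add: D_def dvd_prodI)
      then have "coprime q (E T)" using cop coprime_divisors dvd_refl by blast
      moreover have "\<forall>i<d. q dvd E T * y i"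
        using E(2)[OF TT, of y q r] T by blast
      ultimately have "\<forall>i<d. q dvd y i"
        by (simp add: coprime_dvd_mult_right_iff)
      then show False using y by blast
    qed
  qed
qed

section \<open>Existence of an interior lattice point\<close>

lemma interior_lattice_point:
  assumes d: "d \<ge> 1" and fin: "finite S" and S: "\<And>v. v \<in> S \<Longrightarrow> lattice_point d v"
    and gp: "general_position d S"
    and card: "512 * d * m \<le> card S" and m: "(16 * d) ^ d < 2 ^ m"
  shows "\<exists>z. lattice_point d z \<and> z \<in> interior_d d (conv_hull S)"
proof -
  have m0: "m \<ge> 1"
    using m d by (cases m) auto
  have "d + 1 \<le> 512 * d * m"
  proof -
    have "d * 1 \<le> d * m" using m0 by (intro mult_le_mono) auto
    then show ?thesis using d unfolding mult.assoc by linarith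
  qed
  with card have "d + 1 \<le> card S"
    by linarith
  then obtain T where T: "T \<subseteq> S" "card T = d + 1"
    by (rule obtain_subset_with_card_n) (rule that)
  have "finite T" using T fin finite_subset by blast
  then obtain h where h: "bij_betw h {..d} T"
    using finite_same_card_bij[of "{..d}" T] T by auto
  have hS: "inj_on h {..d}" "h ` {..d} \<subseteq> S"
    using h T by (auto simp: bij_betw_def)
  have hmem: "h i \<in> S" if "i \<le> d" for i
    using hS(2) that by auto
  obtain D where D: "D > 0" and residue: "\<And>q y r. coprime q (int D) \<Longrightarrow> \<exists>i<d. \<not> q dvd y i \<Longrightarrow>
       card {v \<in> S. dot d y (int_vec v) mod q = r} \<le> d"
    by (rule general_position_mod[OF fin _ gp], erule S, rule that)
  \<comment> \<open>The shape of \<open>p\<close> makes it coprime to \<open>D\<close>.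
    \<open>A\<close> is about \<open>p / (4 * m)\<close> and \<open>B\<close> about
    \<open>p / (8 * d)\<close>, so all coefficients together stay below
    \<open>2 * d * B + m * A = 4 * d * m * D < p / 2\<close>, while
    \<open>p \<le> 16 * d * B\<close>.\<close>
  define p where "p = 1 + 8 * (d * m * D)"
  define A where "A = 2 * d * D"
  define B where "B = m * D"
  define f where "f x j = int_vec x j - int_vec (h d) j" for x j
  define M where "M = d + d + m"
  define Q where "Q = (\<lambda>i. (if i < d then {h i} else if i < d + d then {h (i - d)} else S)
                   \<times> {..<(if i < d + d then B else A)})"
  have dmD: "d * m * D \<ge> 1"
    using d m0 D by simp
  have cop: "coprime (int p) (int D)"
  proof -
    have "p = 1 + D * (8 * d * m)" by (simp add: p_def)
    then have "coprime p D" by (metis coprime_1_left coprime_iff_gcd_eq_1 gcd.commute gcd_add_mult add.commute mult.commute)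
    then show ?thesis by simp
  qed
  have dotf: "dot d y (f x) = dot d y (int_vec x) - dot d y (int_vec (h d))" for x y
    by (simp add: dot_def f_def right_diff_distrib sum_subtractf)
  have res: "card {x \<in> S. dot d y (f x) mod int p = r} \<le> d" if "\<exists>i<d. \<not> int p dvd y i" for y r
  proof -
    let ?b = "dot d y (int_vec (h d))"
    have "dot d y (int_vec x) mod int p = (r + ?b) mod int p" if "dot d y (f x) mod int p = r" for x
    proof -
      have "(dot d y (f x) mod int p + ?b) mod int p = dot d y (int_vec x) mod int p"
        unfolding mod_add_left_eq by (simp add: dotf)
      then show ?thesis using that by simp
    qed
    then have "{x \<in> S. dot d y (f x) mod int p = r}
        \<subseteq> {x \<in> S. dot d y (int_vec x) mod int p = (r + ?b) mod int p}"
      by blast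
    then have "card {x \<in> S. dot d y (f x) mod int p = r}
        \<le> card {x \<in> S. dot d y (int_vec x) mod int p = (r + ?b) mod int p}"
      using fin by (intro card_mono) auto
    also have "\<dots> \<le> d"
      by (rule residue[OF cop that])
    finally show ?thesis .
  qed
  \<comment> \<open>Otherwise the \<open>d + 1\<close> points \<open>h i\<close>, including the base
    point \<open>h d\<close> where \<open>f\<close> vanishes, would share the residue 0, against
    \<open>res\<close>.\<close>
  have basis: "\<forall>i<d. int p dvd y i" if y: "\<forall>i<d. int p dvd dot d y (f (h i))" for y
  proof (rule ccontr)
    assume "\<not> ?thesis"
    then have "card {x \<in> S. dot d y (f x) mod int p = 0} \<le> d"
      by (intro res) auto
    moreover have "h ` {..d} \<subseteq> {x \<in> S. dot d y (f x) mod int p = 0}"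
    proof
      fix x assume "x \<in> h ` {..d}"
      then obtain i where i: "i \<le> d" "x = h i" by auto
      then have "int p dvd dot d y (f x)"
        using y by (cases "i = d") (auto simp: dotf)
      then show "x \<in> {x \<in> S. dot d y (f x) mod int p = 0}"
        using i hmem by simp
    qed
    then have "card (h ` {..d}) \<le> card {x \<in> S. dot d y (f x) mod int p = 0}"
      using fin by (intro card_mono) auto
    ultimately show False
      using hS(1) by (simp add: card_image)
  qed
  \<comment> \<open>The target reserves one extra copy of every \<open>h i\<close> with
    \<open>i < d\<close>, so that each of them ends with positive weight. The choice
    \<open>k = 64 * m\<close> turns \<open>8 * k * d\<close> into the assumed
    \<open>512 * d * m\<close>.\<close>
  have "\<exists>g\<in>PiE {..<d + d + m} Q. \<forall>c<d. int p dvd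
           (\<Sum>i<d + d + m. int (snd (g i)) * f (fst (g i)) c) - (- (\<Sum>i<d. f (h i) c))"
    unfolding Q_def
  proof (rule exists_combination_mod[where k = "64 * m"])
    show "B \<le> p"
    proof -
      have "1 * (m * D) \<le> d * (m * D)" using d by (intro mult_le_mono) auto
      then show ?thesis unfolding B_def p_def mult.assoc by linarith
    qed
    show "8 * p \<le> 64 * m * A"
      using dmD by (simp add: A_def p_def algebra_simps)
    show "8 * (64 * m) * d \<le> card S"
      using card by (simp add: mult_ac)
    show "p ^ d < B ^ d * 2 ^ m"
    proof -
      have "p ^ d \<le> (16 * d * B) ^ d"
        using dmD by (intro power_mono) (simp_all add: p_def B_def mult_ac)
      also have "\<dots> = B ^ d * (16 * d) ^ d"
        by (simp add: power_mult_distrib mult_ac)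
      also have "\<dots> < B ^ d * 2 ^ m"
        using m m0 D by (intro mult_strict_left_mono) (simp_all add: B_def)
      finally show ?thesis .
    qed
    show "S \<noteq> {}" using hmem by auto
  qed (use fin m0 res basis in \<open>auto simp: p_def\<close>)
  then obtain g where g: "g \<in> PiE {..<M} Q"
    and cong: "\<And>c. c < d \<Longrightarrow> int p dvd
           (\<Sum>i<M. int (snd (g i)) * f (fst (g i)) c) + (\<Sum>i<d. f (h i) c)"
    unfolding M_def[symmetric] by auto
  define a where "a i = snd (g i)" for i
  define x where "x i = fst (g i)" for i
  have x: "x i \<in> S" if "i < M" for i
  proof -
    have "g i \<in> Q i" using g that by auto
    then show ?thesis
      using hmem that unfolding x_def Q_def by (auto split: if_splits)
  qed
  have a: "a i + 1 \<le> (if i < d + d then B else A)" if "i < M" for i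
  proof -
    have "g i \<in> Q i" using g that by auto
    then show ?thesis
      unfolding a_def Q_def by auto
  qed
  have total: "(\<Sum>i<M. a i) + d + 1 \<le> p"
  proof -
    have "(\<Sum>i<M. a i) + M = (\<Sum>i<M. a i + 1)"
      unfolding sum.distrib by simp
    also have "\<dots> \<le> (\<Sum>i<M. if i < d + d then B else A)"
      by (intro sum_mono a) auto
    also have "\<dots> = (d + d) * B + m * A"
    proof -
      have "(\<Sum>i<k + m. if i < k then B else A) = k * B + m * A" for k
        by (induction m) auto
      then show ?thesis by (simp add: M_def)
    qed
    also have "\<dots> = 4 * (d * m * D)"
      by (simp add: A_def B_def algebra_simps)
    finally show ?thesis
      using d dmD by (simp add: p_def M_def)
  qed
  \<comment> \<open>The base point \<open>h d\<close> receives what is missing to a total of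
    \<open>p\<close>; by \<open>total\<close> this is positive.\<close>
  define rest where "rest = real p - real (\<Sum>i<M. a i) - real d"
  have rest: "rest > 0"
    using total unfolding rest_def by linarith
  have p0: "real p > 0"
    using total by simp
  define W where "W v = ((\<Sum>i<M. real (a i) * of_bool (v = x i)) + (\<Sum>i<d. of_bool (v = h i))
      + rest * of_bool (v = h d)) / real p" for v
  have comb: "(\<Sum>v\<in>S. W v * F v) = ((\<Sum>i<M. real (a i) * F (x i)) + (\<Sum>i<d. F (h i))
      + rest * F (h d)) / real p" for F :: "_ \<Rightarrow> real"
  proof -
    have pick: "(\<Sum>v\<in>S. of_bool (v = w) * F v) = F w" if "w \<in> S" for w
      using fin that by (simp add: of_bool_def if_distrib if_distribR sum.delta cong: if_cong)
    have "(\<Sum>v\<in>S. W v * F v) = ((\<Sum>v\<in>S. \<Sum>i<M. real (a i) * (of_bool (v = x i) * F v))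
        + (\<Sum>v\<in>S. \<Sum>i<d. of_bool (v = h i) * F v) + (\<Sum>v\<in>S. rest * (of_bool (v = h d) * F v))) / real p"
      unfolding W_def sum.distrib[symmetric] sum_divide_distrib
      by (intro sum.cong refl) (simp only: times_divide_eq_left sum_distrib_right distrib_right mult.assoc)
    also have "(\<Sum>v\<in>S. \<Sum>i<M. real (a i) * (of_bool (v = x i) * F v)) = (\<Sum>i<M. real (a i) * F (x i))"
      by (subst sum.swap) (intro sum.cong refl, simp only: sum_distrib_left[symmetric] pick x lessThan_iff)
    also have "(\<Sum>v\<in>S. \<Sum>i<d. of_bool (v = h i) * F v) = (\<Sum>i<d. F (h i))"
      by (subst sum.swap) (intro sum.cong refl, simp only: pick hmem lessThan_iff less_imp_le)
    also have "(\<Sum>v\<in>S. rest * (of_bool (v = h d) * F v)) = rest * F (h d)"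
      by (simp only: sum_distrib_left[symmetric] pick hmem le_refl)
    finally show ?thesis .
  qed
  have W0: "0 \<le> W v" for v
    unfolding W_def using rest by (intro divide_nonneg_nonneg add_nonneg_nonneg sum_nonneg) auto
  have W1: "(\<Sum>v\<in>S. W v) = 1"
    using comb[of "\<lambda>_. 1"] p0 by (simp add: rest_def)
  have Wpos: "0 < W (h i)" if "i \<le> d" for i
  proof -
    have "0 \<le> (\<Sum>j<M. real (a j) * of_bool (h i = x j))"
      by (intro sum_nonneg) auto
    moreover have "0 < (\<Sum>j<d. of_bool (h i = h j)) + rest * of_bool (h i = h d)"
    proof (cases "i = d")
      case True
      then show ?thesis
        using rest by (intro add_nonneg_pos sum_nonneg) auto
    next
      case False
      then have "(1::real) \<le> (\<Sum>j<d. of_bool (h i = h j))"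
        using that member_le_sum[of i "{..<d}" "\<lambda>j. of_bool (h i = h j) :: real"] by simp
      moreover have "0 \<le> rest * of_bool (h i = h d)" using rest by simp
      ultimately show ?thesis by linarith
    qed
    ultimately show ?thesis
      unfolding W_def using p0 by (intro divide_pos_pos) linarith+
  qed
  define z where "z = (\<lambda>l. \<Sum>v\<in>S. W v * v l)"
  obtain N E where E: "E \<noteq> 0" and N: "\<And>i j. i < d \<Longrightarrow> j < d \<Longrightarrow>
      (\<Sum>k<d. N i k * (int_vec (h k) j - int_vec (h d) j)) = (if i = j then E else 0)"
    by (rule general_position_left_inverse[OF _ gp hS], erule S, rule that)
  have "z \<in> interior_d d (conv_hull S)"
    unfolding z_def
  proof (rule positive_weights_interior[where h = h and R = "\<lambda>i k. real_of_int (N i k) / real_of_int E"])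
    show "S \<subseteq> Rd d" using S by (auto simp: lattice_point_def)
    fix i j assume ij: "i < d" "j < d"
    have "(\<Sum>k<d. real_of_int (N i k) / real_of_int E * (h k j - h d j))
        = real_of_int (\<Sum>k<d. N i k * (int_vec (h k) j - int_vec (h d) j)) / real_of_int E"
      by (simp add: sum_divide_distrib real_int_vec[OF S[OF hmem]])
    then show "(\<Sum>k<d. real_of_int (N i k) / real_of_int E * (h k j - h d j)) = (if i = j then 1 else 0)"
      using N[OF ij] E by simp
  qed (use fin hS(2) W0 W1 Wpos in auto)
  moreover have "lattice_point d z"
    unfolding lattice_point_def
  proof (intro conjI allI impI)
    show "z \<in> Rd d"
      using calculation by (simp add: interior_d_def)
    fix c assume c: "c < d"
    obtain q where q: "(\<Sum>i<M. int (a i) * f (x i) c) + (\<Sum>i<d. f (h i) c) = int p * q"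
      using cong[OF c] unfolding a_def x_def by blast
    have f: "real_of_int (f v c) = v c - h d c" if "v \<in> S" for v
      using real_int_vec[OF S[OF that]] real_int_vec[OF S[OF hmem[OF order_refl]]] by (simp add: f_def)
    \<comment> \<open>Because the weights sum to 1, \<open>z\<close> is \<open>h d\<close> plus
      \<open>1 / p\<close> times a combination of differences, and the congruence makes that
      combination divisible by \<open>p\<close>.\<close>
    have "z c = ((\<Sum>i<M. real (a i) * x i c) + (\<Sum>i<d. h i c) + rest * h d c) / real p"
      unfolding z_def by (rule comb)
    also have "(\<Sum>i<M. real (a i) * x i c) + (\<Sum>i<d. h i c) + rest * h d c
        = (\<Sum>i<M. real (a i) * (x i c - h d c)) + (\<Sum>i<d. h i c - h d c) + real p * h d c"
      by (simp add: rest_def right_diff_distrib left_diff_distrib sum_subtractf sum_distrib_right)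
    also have "(\<Sum>i<M. real (a i) * (x i c - h d c)) + (\<Sum>i<d. h i c - h d c)
        = real_of_int ((\<Sum>i<M. int (a i) * f (x i) c) + (\<Sum>i<d. f (h i) c))"
      using f x hmem by simp
    also have "\<dots> = real p * real_of_int q"
      unfolding q by simp
    finally have "z c = real_of_int q + h d c"
      using p0 by (simp add: add_divide_distrib)
    also have "h d c = real_of_int (int_vec (h d) c)"
      using real_int_vec[OF S[OF hmem[OF order_refl]]] by simp
    finally show "z c \<in> \<int>"
      by simp
  qed
  ultimately show ?thesis by blast
qed

section \<open>The bound on the number of vertices\<close>

theorem theorem2p4:
  shows "\<exists>C::real. C > 0 \<and>
    (\<forall>d::nat. \<forall>V::(nat \<Rightarrow> real) set.
       d \<ge> 2 \<longrightarrow> finite V \<longrightarrow> V \<noteq> {} \<longrightarrow> (\<forall>v\<in>V. lattice_point d v) \<longrightarrow>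
       general_position d (vertices (conv_hull V)) \<longrightarrow>
       (\<forall>z. lattice_point d z \<longrightarrow> z \<notin> interior_d d (conv_hull V)) \<longrightarrow>
       real (card (vertices (conv_hull V))) \<le> C * real d ^ 2 * (ln (real d)) ^ 3)"
\<comment> \<open>\<open>24576 = 512 * 48\<close>: the factor 512 comes from
  \<open>interior_lattice_point\<close>, and 48 from bounding \<open>L\<close> by the cube of the
  logarithm.\<close>
proof (intro exI[of _ "24576"] conjI allI impI)
  fix d :: nat and V :: "(nat \<Rightarrow> real) set"
  assume d: "2 \<le> d" and V: "finite V" and lat: "\<forall>v\<in>V. lattice_point d v"
    and gp: "general_position d (vertices (conv_hull V))"
    and empty: "\<forall>z. lattice_point d z \<longrightarrow> z \<notin> interior_d d (conv_hull V)"
  define S where "S = vertices (conv_hull V)"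
  have SV: "S \<subseteq> V"
    unfolding S_def by (rule vertices_conv_hull_subset[OF V])
  then have fin: "finite S" using V finite_subset by blast
  \<comment> \<open>\<open>L\<close> is the number of binary digits of \<open>16 * d\<close>, so
    \<open>16 * d < 2 ^ L\<close> and \<open>m = d * L\<close> meets the requirement on
    \<open>m\<close>.\<close>
  define L where "L = nat \<lfloor>log 2 (16 * real d)\<rfloor> + 1"
  have log0: "0 \<le> log 2 (16 * real d)"
    using d by simp
  have L: "log 2 (16 * real d) < real L" "real L \<le> log 2 (16 * real d) + 1"
    using log0 unfolding L_def by linarith+
  have "16 * real d = 2 powr (log 2 (16 * real d))"
    using d by simp
  also have "\<dots> < 2 powr (real L)"
    using L(1) by simp
  also have "\<dots> = real (2 ^ L)"
    by (simp add: powr_realpow)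
  finally have "real (16 * d) < real (2 ^ L)" by simp
  then have "16 * d < 2 ^ L" by (simp only: of_nat_less_iff)
  then have "(16 * d) ^ d < (2 ^ L) ^ d"
    using d by (intro power_strict_mono) auto
  then have m: "(16 * d) ^ d < 2 ^ (d * L)"
    by (simp add: power_mult[symmetric] mult.commute)
  have "\<not> 512 * d * (d * L) \<le> card S"
  proof
    \<comment> \<open>A lattice point interior to the hull of the vertices is also interior to the
      hull of \<open>V\<close>, by monotonicity.\<close>
    assume "512 * d * (d * L) \<le> card S"
    then obtain z where "lattice_point d z" "z \<in> interior_d d (conv_hull S)"
      using interior_lattice_point[OF _ fin _ _ _ m] d gp lat SV unfolding S_def[symmetric] by auto
    then show False
      using empty interior_d_mono[OF conv_hull_mono[OF V SV]] by blast
  qed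
  then have "real (card S) \<le> real (512 * d * (d * L))"
    by (simp only: of_nat_le_iff)
  also have "\<dots> = 512 * (real d)\<^sup>2 * real L"
    by (simp add: power2_eq_square)
  also have "\<dots> \<le> 512 * (real d)\<^sup>2 * (48 * ln (real d) ^ 3)"
  proof (rule mult_left_mono)
    have ln2: "1 / 2 \<le> ln (2 :: real)"
      using ln_le_minus_one[of "1 / 2 :: real"] by (simp add: ln_div)
    have lnd: "ln 2 \<le> ln (real d)"
      using d by simp
    have "log 2 (16 * real d) = log 2 (2 ^ 4) + log 2 (real d)"
      using d log_mult[of 2 "2 ^ 4" "real d"] by simp
    also have "log 2 (2 ^ 4) = (4 :: real)"
      by (subst log_nat_power) simp_all
    finally have "real L \<le> 5 + ln (real d) / ln 2"
      using L(2) by (simp add: log_def)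
    also have "ln (real d) / ln 2 \<le> ln (real d) / (1 / 2)"
      using ln2 lnd by (intro divide_left_mono) auto
    \<comment> \<open>As \<open>ln d \<ge> 1 / 2\<close>, the 5 is at most \<open>10 * ln d\<close>;
      likewise \<open>4 * (ln d)\<^sup>2 \<ge> 1\<close> then raises the single logarithm to its
      cube.\<close>
    also have "5 + \<dots> \<le> 12 * ln (real d)"
      using ln2 lnd by simp
    also have "\<dots> \<le> 12 * (ln (real d) * (4 * (ln (real d))\<^sup>2))"
    proof -
      have "(1 / 2)\<^sup>2 \<le> (ln (real d))\<^sup>2"
        using ln2 lnd by (intro power_mono) auto
      then have "ln (real d) * 1 \<le> ln (real d) * (4 * (ln (real d))\<^sup>2)"
        using ln2 lnd by (intro mult_left_mono) (auto simp: power2_eq_square)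
      then show ?thesis by simp
    qed
    also have "\<dots> = 48 * ln (real d) ^ 3"
      by (simp add: power2_eq_square power3_eq_cube)
    finally show "real L \<le> 48 * ln (real d) ^ 3" by simp
  qed simp
  finally show "real (card (vertices (conv_hull V))) \<le> 24576 * real d ^ 2 * ln (real d) ^ 3"
    by (simp add: S_def)
qed simp

end
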